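(* Let $G$ be a graph of order $n\geq 2$ with $\nu_2(\overline{G^2})=p$. Then for every $t\geq 2$, $\lambda(M^t(G))\leq 2^{t-1}(2n-p+2)-2$.
   Context: Graphs are finite, simple, undirected. $G^2$ is the square of $G$: same vertex set, with $xy$ an edge iff $1\le d_G(x,y)\le 2$; $\overline{G^2}$ is its complement (so $xy$ is an edge of $\overline{G^2}$ iff $d_G(x,y)\ge 3$, including infinite distance). A 2-matching of a graph $H$ is an assignment of weights $0,1,2$ to the edges of $H$ such that the sum of weights of edges incident to each vertex is at most 2; its size is the total weight, and $\nu_2(H)$ is the maximum size of a 2-matching of $H$. An $L(2,1)$-labeling of $G$ is a map $f:V\to\{0,1,2,\dots\}$ with $|f(x)-f(y)|\ge 2$ if $d_G(x,y)=1$ and $|f(x)-f(y)|\ge1$ if $d_G(x,y)=2$; $\lambda(G)$ is the minimum over such $f$ of the largest label. For $V=\{v_1,\dots,v_n\}$, $M(G)$ has vertex set $V\cup\{v_1',\dots,v_n'\}\cup\{u\}$ and edge set $E\cup\{v_iv_j' : v_iv_j\in E\}\cup\{v_i'u: 1\le i\le n\}$; $M^0(G)=G$, $M^t(G)=M(M^{t-1}(G))$. *)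

theory Defs
  imports "Graph_Theory.Graph_Theory"
begin

text \<open>
  A finite simple undirected graph is a \<^locale>\<open>pair_graph\<close>: a finite, loop-free, symmetric digraph
  without parallel arcs. The undirected edge \<open>xy\<close> is represented by the two arcs \<open>(x, y)\<close>, \<open>(y, x)\<close>.
\<close>

definition gdist :: "'a pair_pre_digraph \<Rightarrow> 'a \<Rightarrow> 'a \<Rightarrow> ereal" where
  "gdist G x y = wf_digraph.\<mu> (with_proj G) (\<lambda>_. 1) x y"

definition graph_square :: "'a pair_pre_digraph \<Rightarrow> 'a pair_pre_digraph" where
  "graph_square G = \<lparr> pverts = pverts G,
     parcs = {(x, y). x \<in> pverts G \<and> y \<in> pverts G \<and> 1 \<le> gdist G x y \<and> gdist G x y \<le> 2} \<rparr>"

definition graph_complement :: "'a pair_pre_digraph \<Rightarrow> 'a pair_pre_digraph" where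
  "graph_complement G = \<lparr> pverts = pverts G,
     parcs = {(x, y). x \<in> pverts G \<and> y \<in> pverts G \<and> x \<noteq> y \<and> (x, y) \<notin> parcs G} \<rparr>"

definition uedges :: "'a pair_pre_digraph \<Rightarrow> 'a set set" where
  "uedges G = {{x, y} | x y. (x, y) \<in> parcs G}"

definition two_matching :: "'a pair_pre_digraph \<Rightarrow> ('a set \<Rightarrow> nat) \<Rightarrow> bool" where
  "two_matching H w \<longleftrightarrow>
     (\<forall>e \<in> uedges H. w e \<in> {0, 1, 2}) \<and>
     (\<forall>v \<in> pverts H. (\<Sum>e \<in> {e \<in> uedges H. v \<in> e}. w e) \<le> 2)"

definition nu2 :: "'a pair_pre_digraph \<Rightarrow> nat" where
  "nu2 H = Max {(\<Sum>e \<in> uedges H. w e) | w. two_matching H w}"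

definition L21_labeling :: "'a pair_pre_digraph \<Rightarrow> ('a \<Rightarrow> nat) \<Rightarrow> bool" where
  "L21_labeling G f \<longleftrightarrow>
     (\<forall>x \<in> pverts G. \<forall>y \<in> pverts G.
        (gdist G x y = 1 \<longrightarrow> \<bar>int (f x) - int (f y)\<bar> \<ge> 2) \<and>
        (gdist G x y = 2 \<longrightarrow> \<bar>int (f x) - int (f y)\<bar> \<ge> 1))"

definition lambda21 :: "'a pair_pre_digraph \<Rightarrow> nat" where
  "lambda21 G = (LEAST k. \<exists>f. L21_labeling G f \<and> k = Max (f ` pverts G))"

text \<open>
  A vertex type closed under the Mycielski construction, so that the construction can be iterated
  within a single type. The constructors \<open>Old\<close>, \<open>Copy\<close>, \<open>Root\<close> tag the three parts of the vertex set
  of the Mycielskian (\<open>v\<close>, \<open>v'\<close> and \<open>u\<close>) and keep them disjoint; \<open>Base\<close> only embeds the vertices of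
  the initial graph.
\<close>

datatype 'a mvert = Base 'a | Old "'a mvert" | Copy "'a mvert" | Root

definition base_graph :: "'a pair_pre_digraph \<Rightarrow> 'a mvert pair_pre_digraph" where
  "base_graph G = \<lparr> pverts = Base ` pverts G, parcs = map_prod Base Base ` parcs G \<rparr>"

definition mycielskian :: "'a mvert pair_pre_digraph \<Rightarrow> 'a mvert pair_pre_digraph" where
  "mycielskian G = \<lparr>
     pverts = Old ` pverts G \<union> Copy ` pverts G \<union> {Root},
     parcs = {(Old x, Old y) | x y. (x, y) \<in> parcs G}
           \<union> {(Old x, Copy y) | x y. (x, y) \<in> parcs G}
           \<union> {(Copy y, Old x) | x y. (x, y) \<in> parcs G}
           \<union> {(Copy x, Root) | x. x \<in> pverts G}
           \<union> {(Root, Copy x) | x. x \<in> pverts G} \<rparr>"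

definition mycielski_iter :: "nat \<Rightarrow> 'a pair_pre_digraph \<Rightarrow> 'a mvert pair_pre_digraph" where
  "mycielski_iter t G = (mycielskian ^^ t) (base_graph G)"

lemma pair_graphI':
  assumes "finite (pverts G)"
    and "\<And>x y. (x, y) \<in> parcs G \<Longrightarrow> x \<in> pverts G \<and> y \<in> pverts G \<and> x \<noteq> y \<and> (y, x) \<in> parcs G"
  shows "pair_graph G"
proof -
  have "parcs G \<subseteq> pverts G \<times> pverts G" using assms(2) by auto
  then have "finite (parcs G)" using assms(1) finite_subset by blast
  with assms show ?thesis
    by unfold_locales (auto simp: symmetric_def sym_def)
qed

lemma pair_graph_arcD:
  assumes "pair_graph G" "(x, y) \<in> parcs G"
  shows "x \<in> pverts G" "y \<in> pverts G" "x \<noteq> y" "(y, x) \<in> parcs G"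
proof -
  interpret pair_graph G by fact
  show "x \<in> pverts G" "y \<in> pverts G" "x \<noteq> y" "(y, x) \<in> parcs G"
    using assms(2) by (auto dest: in_arcsD1 in_arcsD2 no_loops' arcs_symmetric)
qed

lemma pair_graph_finite: "pair_graph G \<Longrightarrow> finite (pverts G)"
  by (simp add: pair_graph_def pair_digraph_def pair_fin_digraph_def pair_fin_digraph_axioms_def)

lemma pair_graph_base_graph: "pair_graph G \<Longrightarrow> pair_graph (base_graph G)"
  by (rule pair_graphI')
    (auto simp: base_graph_def pair_graph_finite dest: pair_graph_arcD intro: rev_image_eqI)

lemma pair_graph_mycielskian: "pair_graph G \<Longrightarrow> pair_graph (mycielskian G)"
  by (rule pair_graphI') (auto simp: mycielskian_def pair_graph_finite dest: pair_graph_arcD)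

lemma pair_graph_mycielski_iter: "pair_graph G \<Longrightarrow> pair_graph (mycielski_iter t G)"
  unfolding mycielski_iter_def
  by (induction t) (auto intro: pair_graph_base_graph pair_graph_mycielskian)

lemma pair_graph_complement: "pair_graph G \<Longrightarrow> pair_graph (graph_complement G)"
  by (rule pair_graphI')
    (auto simp: graph_complement_def pair_graph_finite dest: pair_graph_arcD)

end

theory Submission
  imports Defs
begin

text \<open>
  Call two vertices far if their distance is at least 3. A 2-matching of weight \<open>p\<close> on far pairs can
  be turned into a partition of the vertex set into far pairs, odd cycles of consecutively far
  vertices and at most \<open>n - p\<close> single vertices. If \<open>x, y\<close> are far in \<open>G\<close>, then so are \<open>Old x, Copy y\<close>
  and \<open>Copy x, Old y\<close> in \<open>M(G)\<close>; hence the weight of a 2-matching doubles with each Mycielski step.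

  In \<open>M(M(K))\<close> the vertices are grouped into classes whose members share a label: for consecutive
  vertices \<open>x, y\<close> of a cycle or pair of \<open>K\<close> these are \<open>P x y = {Old (Old x), Copy (Copy y)}\<close> and
  \<open>Q x y = {Old (Copy x), Copy (Old y)}\<close>; a single vertex gives four singletons.
  Numbering the classes consecutively is an \<open>L(2,1)\<close>-labeling as soon as neighbouring classes are
  never joined by an edge. Along a cycle \<open>x, y, z, ...\<close> the order \<open>P x y, Q x y, P y z, Q y z, ...\<close>
  works. To pass from the last class \<open>Q z z'\<close> of one block to the next block, enter the latter at a
  vertex adjacent to neither \<open>z\<close> nor \<open>z'\<close>. If there is none, adjacency to \<open>z\<close> and to \<open>z'\<close>
  alternates along the block, so the block is not an odd cycle but a pair, and a pair can then be
  entered at a \<open>Q\<close> class.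
\<close>

section \<open>Decomposing a 2-matching\<close>

text \<open>Even cycles have no case of their own because they split into pairs.\<close>

definition block :: "('a \<Rightarrow> 'a \<Rightarrow> bool) \<Rightarrow> 'a list \<Rightarrow> bool" where
  "block R xs \<longleftrightarrow> (\<exists>x. xs = [x]) \<or> (\<exists>x y. R x y \<and> xs = [x, y]) \<or>
     (odd (length xs) \<and> 3 \<le> length xs \<and> successively R xs \<and> R (last xs) (hd xs))"

text \<open>Half the number of label classes that the block occupies in the second Mycielskian.\<close>

definition cost :: "'a list \<Rightarrow> nat" where
  "cost xs = (if length xs = 1 then 2 else length xs)"

text \<open>Pair off consecutive vertices. This disposes of the even cycles that arise in
  \<open>block_decomposition\<close>.\<close>

lemma even_path_blocks:
  assumes "successively R xs" "even (length xs)"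
  shows "\<exists>bs. \<Union> (set ` set bs) = set xs \<and> (\<forall>b \<in> set bs. block R b) \<and>
    sum_list (map cost bs) = length xs"
  using assms
proof (induction xs rule: induct_list012)
  case (3 x y zs)
  have "successively R zs" "R x y"
    using "3.prems"(1) by (auto simp: successively_Cons)
  then obtain bs where "\<Union> (set ` set bs) = set zs" "\<forall>b \<in> set bs. block R b"
    "sum_list (map cost bs) = length zs"
    using "3.IH"(1) "3.prems"(2) by auto
  then show ?case
    using \<open>R x y\<close> by (intro exI[of _ "[x, y] # bs"]) (auto simp: block_def cost_def[of "[x, y]"])
qed (auto intro: exI[of _ "[]"])

text \<open>A longest path closes up. By maximality all neighbours of its first vertex lie on it;
  the one other than the second vertex must be the last, because both neighbours of an inner vertex
  are the ones beside it on the path.\<close>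

lemma two_regular_cycle:
  fixes N :: "'a \<Rightarrow> 'a set"
  assumes "finite V" "V \<noteq> {}"
    and N: "\<And>v. v \<in> V \<Longrightarrow> N v \<subseteq> V \<and> card (N v) = 2 \<and> v \<notin> N v"
    and sym: "\<And>u v. u \<in> V \<Longrightarrow> v \<in> N u \<Longrightarrow> u \<in> N v"
  shows "\<exists>xs. xs \<noteq> [] \<and> distinct xs \<and> set xs \<subseteq> V \<and> successively (\<lambda>x y. y \<in> N x) xs \<and>
    hd xs \<in> N (last xs) \<and> (\<forall>v \<in> set xs. N v \<subseteq> set xs)"
proof -
  define path where "path xs \<longleftrightarrow> xs \<noteq> [] \<and> distinct xs \<and> set xs \<subseteq> V \<and>
    successively (\<lambda>x y. y \<in> N x) xs" for xs
  obtain v where "v \<in> V" using \<open>V \<noteq> {}\<close> by blast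
  then have "path [v]" by (simp add: path_def)
  moreover have "length xs < Suc (card V)" if "path xs" for xs
    using that \<open>finite V\<close> card_mono distinct_card unfolding path_def by (metis less_Suc_eq_le)
  ultimately obtain xs where xs: "path xs" and max: "\<And>ys. path ys \<Longrightarrow> length ys \<le> length xs"
    using ex_has_greatest_nat[of path "[v]" length "Suc (card V)"] by blast
  define k where "k = length xs"
  have nth_V: "xs ! i \<in> V" if "i < k" for i
    using xs that by (auto simp: path_def k_def)
  have inj: "xs ! i = xs ! j \<longleftrightarrow> i = j" if "i < k" "j < k" for i j
    using xs that by (simp add: path_def k_def nth_eq_iff_index_eq)
  have step: "xs ! Suc i \<in> N (xs ! i)" if "Suc i < k" for i
    using xs that by (auto simp: path_def k_def successively_conv_nth)
  have step': "xs ! i \<in> N (xs ! Suc i)" if "Suc i < k" for i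
    using sym[OF nth_V step] that by simp
  have "k > 0" using xs by (simp add: path_def k_def)
  have ends: "N (xs ! 0) \<subseteq> set xs"
  proof
    fix u assume u: "u \<in> N (xs ! 0)"
    show "u \<in> set xs"
    proof (rule ccontr)
      assume "u \<notin> set xs"
      moreover have "xs ! 0 \<in> N u" "u \<in> V"
        using sym[OF nth_V[OF \<open>k > 0\<close>] u] N[OF nth_V[OF \<open>k > 0\<close>]] u by blast+
      ultimately have "path (u # xs)"
        using xs by (auto simp: path_def successively_Cons hd_conv_nth)
      then show False using max by fastforce
    qed
  qed
  \<comment> \<open>Pure counting, hence valid also for \<open>k = 1\<close>, where
    \<open>xs ! 1\<close> is unspecified.\<close>
  have "\<not> N (xs ! 0) \<subseteq> {xs ! 1}"
    using N[OF nth_V[OF \<open>k > 0\<close>]] card_mono[of "{xs ! 1}" "N (xs ! 0)"] by auto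
  then obtain j where j: "xs ! j \<in> N (xs ! 0)" "j < k" "j \<noteq> 1"
    using ends by (auto simp: in_set_conv_nth k_def subset_iff)
  have "j \<noteq> 0" using j(1) N[OF nth_V[OF \<open>k > 0\<close>]] by metis
  have N_eq: "N v = {a, b}" if "v \<in> V" "a \<in> N v" "b \<in> N v" "a \<noteq> b" for v a b
  proof -
    have "finite (N v)" "card (N v) = 2" using N[OF that(1)] \<open>finite V\<close> finite_subset by auto
    then show ?thesis using that card_subset_eq[of "N v" "{a, b}"] by auto
  qed
  have wrap: "xs ! 0 \<in> N (xs ! j)" by (rule sym[OF nth_V[OF \<open>k > 0\<close>] j(1)])
  have "Suc j = k"
  proof (rule ccontr)
    assume "Suc j \<noteq> k"
    then have "Suc j < k" using j by simp
    have "xs ! (j - 1) \<in> N (xs ! j)" using step'[of "j - 1"] \<open>j \<noteq> 0\<close> j by simp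
    moreover have "xs ! Suc j \<in> N (xs ! j)" using step \<open>Suc j < k\<close> by simp
    moreover have "xs ! (j - 1) \<noteq> xs ! Suc j"
      using inj[of "j - 1" "Suc j"] \<open>Suc j < k\<close> by simp
    ultimately have "N (xs ! j) = {xs ! (j - 1), xs ! Suc j}"
      using N_eq nth_V j by blast
    then have "xs ! 0 = xs ! (j - 1) \<or> xs ! 0 = xs ! Suc j" using wrap by blast
    \<comment> \<open>On naturals \<open>0 = j - 1\<close> only gives \<open>j \<le> 1\<close>,
      which \<open>j \<noteq> 0\<close> and \<open>j \<noteq> 1\<close> exclude.\<close>
    then have "0 = j - 1 \<or> 0 = Suc j"
      using inj[OF \<open>k > 0\<close>, of "j - 1"] inj[OF \<open>k > 0\<close> \<open>Suc j < k\<close>] \<open>Suc j < k\<close> by linarith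
    then show False using j(3) \<open>j \<noteq> 0\<close> by linarith
  qed
  then have "length xs - 1 = j" by (simp add: k_def)
  then have last: "last xs = xs ! j" and hd: "hd xs = xs ! 0"
    using xs by (auto simp: path_def last_conv_nth hd_conv_nth)
  have closed: "N (xs ! i) \<subseteq> set xs" if i: "i < k" for i
  proof -
    consider "i = 0" | "i = j" "i \<noteq> 0" | "i \<noteq> 0" "Suc i < k" using i \<open>Suc j = k\<close> by linarith
    then show ?thesis
    proof cases
      case 1 then show ?thesis using ends by simp
    next
      case 2
      have "xs ! (j - 1) \<in> N (xs ! j)" using step'[of "j - 1"] \<open>j \<noteq> 0\<close> j by simp
      moreover have "xs ! (j - 1) \<noteq> xs ! 0" using inj[of "j - 1" 0] \<open>j \<noteq> 0\<close> j by auto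
      ultimately have "N (xs ! j) = {xs ! (j - 1), xs ! 0}"
        using N_eq nth_V j wrap by blast
      moreover have "xs ! (j - 1) \<in> set xs" "xs ! 0 \<in> set xs"
        using j(2) \<open>k > 0\<close> unfolding k_def by (auto intro!: nth_mem simp del: length_greater_0_conv)
      ultimately show ?thesis using 2 by simp
    next
      case 3
      have "xs ! (i - 1) \<in> N (xs ! i)" using step'[of "i - 1"] 3 by simp
      moreover have "xs ! Suc i \<in> N (xs ! i)" using step 3 by simp
      moreover have "xs ! (i - 1) \<noteq> xs ! Suc i" using inj[of "i - 1" "Suc i"] 3 by simp
      ultimately have "N (xs ! i) = {xs ! (i - 1), xs ! Suc i}" using N_eq nth_V i by blast
      then show ?thesis using 3 by (auto simp: k_def)
    qed
  qed
  have "N v \<subseteq> set xs" if "v \<in> set xs" for v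
    using closed that unfolding k_def by (metis in_set_conv_nth)
  then show ?thesis
    using xs wrap last hd by (intro exI[of _ xs]) (simp add: path_def)
qed

text \<open>The double sum counts each pair twice, so the bound says that the cost is at most
  \<open>2 * card V\<close> minus the weight. Induction removes a set \<open>S\<close> for which
  twice the cost of its blocks plus the lost double sum is at most \<open>4 * card S\<close>: a
  vertex of weight 0, a vertex with its only neighbour, or, when every vertex has two neighbours, a
  cycle.\<close>

lemma block_decomposition:
  fixes w :: "'a \<Rightarrow> 'a \<Rightarrow> nat"
  assumes "finite V"
    and sym: "\<And>x y. w x y = w y x"
    and supp: "\<And>x y. w x y > 0 \<Longrightarrow> R x y"
    and irrefl: "\<And>x. \<not> R x x"
    and deg: "\<And>x. x \<in> V \<Longrightarrow> (\<Sum>y\<in>V. w x y) \<le> 2"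
  shows "\<exists>bs. \<Union> (set ` set bs) = V \<and> (\<forall>b \<in> set bs. block R b) \<and>
    2 * sum_list (map cost bs) + (\<Sum>x\<in>V. \<Sum>y\<in>V. w x y) \<le> 4 * card V"
  using assms(1) deg
proof (induction V rule: finite_psubset_induct)
  case (psubset V)
  have ind: ?case
    if S: "S \<subseteq> V" "S \<noteq> {}" and as: "\<Union> (set ` set as) = S" "\<forall>b \<in> set as. block R b"
      and le: "2 * sum_list (map cost as) + (\<Sum>x\<in>V. \<Sum>y\<in>V. w x y)
        \<le> 4 * card S + (\<Sum>x\<in>V-S. \<Sum>y\<in>V-S. w x y)" for S as
  proof -
    have "(\<Sum>y\<in>V - S. w x y) \<le> 2" if "x \<in> V - S" for x
      using psubset.prems[of x] that sum_mono2[of V "V - S" "w x"] psubset.hyps by auto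
    then obtain bs where bs: "\<Union> (set ` set bs) = V - S" "\<forall>b \<in> set bs. block R b"
      "2 * sum_list (map cost bs) + (\<Sum>x\<in>V-S. \<Sum>y\<in>V-S. w x y) \<le> 4 * card (V - S)"
      using psubset.IH[of "V - S"] S by blast
    have "card V = card S + card (V - S)"
      using S psubset.hyps by (simp add: card_Diff_subset card_mono finite_subset)
    then show ?thesis
      using as bs S le by (intro exI[of _ "as @ bs"]) auto
  qed
  have split: "(\<Sum>y\<in>V. f y) = (\<Sum>y\<in>S. f y) + (\<Sum>y\<in>V - S. f y)" if "S \<subseteq> V" for S and f :: "'a \<Rightarrow> nat"
    using that psubset.hyps by (metis add.commute sum.subset_diff)
  consider "V = {}" | v where "v \<in> V" "\<forall>u\<in>V. w v u = 0"
    | v u where "v \<in> V" "u \<in> V" "w v u > 0" "\<forall>y\<in>V. y \<noteq> u \<longrightarrow> w v y = 0"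
    | "V \<noteq> {}" "\<forall>v\<in>V. \<exists>u\<in>V. w v u > 0 \<and> (\<exists>y\<in>V. y \<noteq> u \<and> w v y > 0)"
    by (metis gr0I)
  then show ?case
  proof cases
    case 1 then show ?thesis by (intro exI[of _ "[]"]) simp
  next
    case 2
    have z: "w u v = 0" if "u \<in> V" for u using 2 that sym by metis
    have "(\<Sum>x\<in>V. \<Sum>y\<in>V. w x y) = (\<Sum>x\<in>V-{v}. \<Sum>y\<in>V-{v}. w x y)"
      using 2 z by (simp add: split[of "{v}"])
    then show ?thesis
      using 2 by (intro ind[of "{v}" "[[v]]"]) (auto simp: block_def cost_def)
  next
    case 3
    have "u \<noteq> v" using 3 supp irrefl by blast
    let ?S = "{v, u}"
    have sub: "?S \<subseteq> V" using 3 by simp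
    \<comment> \<open>\<open>u\<close> is the only neighbour of \<open>v\<close>, so deleting both loses weight at most 2.\<close>
    have rv: "(\<Sum>y\<in>V. w v y) = w v u"
      using 3 psubset.hyps by (simp add: sum.remove[of V u])
    have ru: "(\<Sum>y\<in>V. w u y) \<le> 2" using psubset.prems 3 by blast
    have "(\<Sum>y\<in>V. w u y) = w v u + w u u + (\<Sum>y\<in>V-?S. w u y)"
      using \<open>u \<noteq> v\<close> sym[of u v] by (simp add: split[OF sub])
    then have cu: "w v u + (\<Sum>y\<in>V-?S. w u y) \<le> 2" using ru by simp
    have "w x v = 0" if "x \<in> V - ?S" for x using 3 that sym[of x v] by simp
    then have col: "(\<Sum>x\<in>V-?S. \<Sum>y\<in>?S. w x y) = (\<Sum>y\<in>V-?S. w u y)"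
      using \<open>u \<noteq> v\<close> sym[of _ u] by simp
    have "(\<Sum>x\<in>V. \<Sum>y\<in>V. w x y) = (\<Sum>x\<in>?S. \<Sum>y\<in>V. w x y) + (\<Sum>x\<in>V-?S. \<Sum>y\<in>V. w x y)"
      by (rule split[OF sub])
    also have "(\<Sum>x\<in>V-?S. \<Sum>y\<in>V. w x y)
      = (\<Sum>x\<in>V-?S. \<Sum>y\<in>?S. w x y) + (\<Sum>x\<in>V-?S. \<Sum>y\<in>V-?S. w x y)"
      by (simp only: split[OF sub] sum.distrib)
    also have "(\<Sum>x\<in>?S. \<Sum>y\<in>V. w x y) = w v u + (\<Sum>y\<in>V. w u y)"
      using \<open>u \<noteq> v\<close> rv by simp
    finally have "(\<Sum>x\<in>V. \<Sum>y\<in>V. w x y) \<le> 4 + (\<Sum>x\<in>V-?S. \<Sum>y\<in>V-?S. w x y)"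
      using ru cu col by linarith
    then show ?thesis
      using 3 \<open>u \<noteq> v\<close> supp by (intro ind[of "{v, u}" "[[v, u]]"]) (auto simp: block_def cost_def)
  next
    case 4
    define N where "N v = {u \<in> V. w v u > 0}" for v
    \<comment> \<open>The positive entries of a row are integers with sum at most 2, and the case
      assumption supplies two of them.\<close>
    have card_N: "card (N v) = 2" if v: "v \<in> V" for v
    proof (rule antisym)
      have fin: "finite (N v)" using psubset.hyps by (simp add: N_def)
      have "card (N v) \<le> (\<Sum>y\<in>N v. w v y)"
        using sum_mono[of "N v" "\<lambda>_. 1" "w v"] by (simp add: N_def Suc_leI)
      also have "\<dots> \<le> (\<Sum>y\<in>V. w v y)" using psubset.hyps by (intro sum_mono2) (auto simp: N_def)
      also have "\<dots> \<le> 2" using psubset.prems v by blast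
      finally show "card (N v) \<le> 2" .
      obtain a b where "a \<in> V" "w v a > 0" "b \<in> V" "b \<noteq> a" "w v b > 0" using 4 v by blast
      then have "a \<noteq> b" "{a, b} \<subseteq> N v" by (auto simp: N_def)
      then show "2 \<le> card (N v)" using card_mono[OF fin, of "{a, b}"] by simp
    qed
    have "N v \<subseteq> V \<and> card (N v) = 2 \<and> v \<notin> N v" if "v \<in> V" for v
      using card_N[OF that] supp irrefl by (auto simp: N_def)
    moreover have "u \<in> N v" if "u \<in> V" "v \<in> N u" for u v
      using that sym[of u v] by (simp add: N_def)
    ultimately obtain xs where xs: "xs \<noteq> []" "distinct xs" "set xs \<subseteq> V"
      "successively (\<lambda>x y. y \<in> N x) xs" "hd xs \<in> N (last xs)" "\<forall>v \<in> set xs. N v \<subseteq> set xs"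
      using two_regular_cycle[of V N] psubset.hyps 4(1) by blast
    have path: "successively R xs" and close: "R (last xs) (hd xs)"
      using xs(4,5) supp by (auto simp: N_def elim: successively_mono)
    let ?S = "set xs"
    have "\<exists>as. \<Union> (set ` set as) = ?S \<and> (\<forall>b \<in> set as. block R b) \<and>
      sum_list (map cost as) = length xs"
    proof (cases "even (length xs)")
      case True then show ?thesis using even_path_blocks path by blast
    next
      case False
      moreover have "length xs \<noteq> 1"
        using close irrefl by (auto simp: length_Suc_conv)
      ultimately have "3 \<le> length xs" by presburger
      then show ?thesis using False path close
        by (intro exI[of _ "[xs]"]) (auto simp: block_def cost_def)
    qed
    then obtain as where as: "\<Union> (set ` set as) = ?S" "\<forall>b \<in> set as. block R b"
      "sum_list (map cost as) = card ?S"
      using xs(2) by (auto simp: distinct_card)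
    \<comment> \<open>The cycle is closed under \<open>N\<close>, so no weight joins it to the rest;
      deleting it loses only its own rows, each at most 2.\<close>
    have z: "w x y = 0" if "x \<in> V - ?S" "y \<in> ?S" for x y
      using xs(6) that sym[of x y] by (force simp: N_def)
    have "(\<Sum>x\<in>V. \<Sum>y\<in>V. w x y) = (\<Sum>x\<in>?S. \<Sum>y\<in>V. w x y) + (\<Sum>x\<in>V-?S. \<Sum>y\<in>V. w x y)"
      by (rule split[OF xs(3)])
    also have "(\<Sum>x\<in>V-?S. \<Sum>y\<in>V. w x y) = (\<Sum>x\<in>V-?S. \<Sum>y\<in>V-?S. w x y)"
      by (rule sum.cong[OF refl]) (simp add: split[OF xs(3)] z)
    also have "(\<Sum>x\<in>?S. \<Sum>y\<in>V. w x y) \<le> (\<Sum>x\<in>?S. 2)"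
      using psubset.prems xs(3) by (intro sum_mono) auto
    finally have "(\<Sum>x\<in>V. \<Sum>y\<in>V. w x y) \<le> 2 * card ?S + (\<Sum>x\<in>V-?S. \<Sum>y\<in>V-?S. w x y)"
      by simp
    then show ?thesis using as xs by (intro ind[of ?S as]) auto
  qed
qed

section \<open>Distances and labelings\<close>

text \<open>Distance at least 3 in terms of arcs, a form that can be checked directly in a
  Mycielskian; \<open>complement_square_arc_iff\<close> ties it to the distance.\<close>

definition far :: "'a pair_pre_digraph \<Rightarrow> 'a \<Rightarrow> 'a \<Rightarrow> bool" where
  "far G x y \<longleftrightarrow> x \<in> pverts G \<and> y \<in> pverts G \<and> x \<noteq> y \<and> (x, y) \<notin> parcs G \<and>
     (\<forall>z. (x, z) \<in> parcs G \<longrightarrow> (z, y) \<notin> parcs G)"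

lemma gdist_le:
  assumes "pair_graph G" "pre_digraph.awalk (with_proj G) x as y"
  shows "gdist G x y \<le> ereal (length as)"
proof -
  interpret pair_graph G by fact
  show ?thesis
    using min_cost_le_walk_cost[OF assms(2), of "\<lambda>_. 1"]
    by (simp add: gdist_def awalk_cost_def sum_list_triv)
qed

text \<open>The distance is an infimum over walks; with no walk at all it is infinite, so
  disconnected vertices are covered.\<close>

lemma gdist_ge:
  assumes "pair_graph G" "\<And>as. pre_digraph.awalk (with_proj G) x as y \<Longrightarrow> k \<le> length as"
  shows "ereal (real k) \<le> gdist G x y"
proof -
  interpret pair_graph G by fact
  show ?thesis
    unfolding gdist_def \<mu>_def using assms(2)
    by (intro INF_greatest) (simp add: awalk_cost_def sum_list_triv)
qed

lemma gdist_self: "pair_graph G \<Longrightarrow> x \<in> pverts G \<Longrightarrow> gdist G x x \<le> 0"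
proof -
  assume G: "pair_graph G" "x \<in> pverts G"
  interpret pair_graph G by fact
  show ?thesis using gdist_le[OF G(1), of x "[]" x] G(2) by (simp add: awalk_Nil_iff zero_ereal_def)
qed

lemma gdist_1_imp_arc:
  assumes G: "pair_graph G" and "x \<in> pverts G" "gdist G x y = 1"
  shows "(x, y) \<in> parcs G"
proof (rule ccontr)
  assume n: "(x, y) \<notin> parcs G"
  interpret pair_graph G by fact
  have "x \<noteq> y" using gdist_self[OF G] assms by force
  \<comment> \<open>\<open>remdups_adj.cases\<close> serves only to split lists into those of length
    0, 1 and at least 2.\<close>
  have "2 \<le> length as" if "awalk x as y" for as
    using that n \<open>x \<noteq> y\<close>
    by (cases as rule: remdups_adj.cases) (auto simp: awalk_simps)
  then have "ereal (real 2) \<le> gdist G x y" by (intro gdist_ge G)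
  then show False using assms by (simp add: one_ereal_def)
qed

lemma far_gdist:
  assumes G: "pair_graph G" and "far G x y"
  shows "gdist G x y > 2"
proof -
  interpret pair_graph G by fact
  have "3 \<le> length as" if "awalk x as y" for as
  proof (rule ccontr)
    assume "\<not> 3 \<le> length as"
    then consider "as = []" | a where "as = [a]" | a b where "as = [a, b]"
      by (cases as rule: remdups_adj.cases) (auto simp: Suc_le_eq numeral_eq_Suc)
    then show False
      using that assms(2) by cases (auto simp: awalk_simps far_def)
  qed
  then have "ereal (real 3) \<le> gdist G x y" by (intro gdist_ge G)
  moreover have "(2::ereal) < ereal (real 3)" by simp
  ultimately show ?thesis by (rule less_le_trans[rotated])
qed

lemma complement_square_arc_iff:
  assumes G: "pair_graph G"
  shows "(x, y) \<in> parcs (graph_complement (graph_square G)) \<longleftrightarrow> far G x y"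
proof
  interpret pair_graph G by fact
  assume "far G x y"
  then show "(x, y) \<in> parcs (graph_complement (graph_square G))"
    using far_gdist[OF G, of x y] by (auto simp: graph_complement_def graph_square_def far_def)
next
  interpret pair_graph G by fact
  assume "(x, y) \<in> parcs (graph_complement (graph_square G))"
  then have xy: "x \<in> pverts G" "y \<in> pverts G" "x \<noteq> y"
    and dist: "1 \<le> gdist G x y \<Longrightarrow> \<not> gdist G x y \<le> 2"
    by (auto simp: graph_complement_def graph_square_def)
  \<comment> \<open>Distinct vertices are at distance at least 1, so the square can omit the arc
    only because the distance exceeds 2.\<close>
  have "1 \<le> length as" if "awalk x as y" for as
    using that xy by (cases as) (auto simp: awalk_simps)
  then have "ereal (real 1) \<le> gdist G x y" by (intro gdist_ge G)
  then have *: "\<not> gdist G x y \<le> 2" using dist by (simp add: one_ereal_def)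
  have "\<not> length as \<le> 2" if "awalk x as y" for as
  proof
    assume "length as \<le> 2"
    then have "ereal (real (length as)) \<le> 2" by simp
    then show False using gdist_le[OF G that] * by (metis order_trans)
  qed
  note short = this
  have "(x, y) \<notin> parcs G"
    using short[of "[(x, y)]"] xy by (auto simp: awalk_simps)
  moreover have "(z, y) \<notin> parcs G" if "(x, z) \<in> parcs G" for z
    using short[of "[(x, z), (z, y)]"] xy that by (auto simp: awalk_simps)
  ultimately show "far G x y" using xy by (auto simp: far_def)
qed

lemma far_sym: "pair_graph G \<Longrightarrow> far G x y \<Longrightarrow> far G y x"
  unfolding far_def using pair_graph_arcD(4) by metis

section \<open>Labelings from ordered lists of classes\<close>

definition separated :: "'a pair_pre_digraph \<Rightarrow> 'a set \<Rightarrow> 'a set \<Rightarrow> bool" where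
  "separated G A B \<longleftrightarrow> (\<forall>a\<in>A. \<forall>b\<in>B. (a, b) \<notin> parcs G)"

text \<open>Required of vertices that share a label, whereas \<open>separated\<close> is required of
  classes with consecutive labels.\<close>

definition scattered :: "'a pair_pre_digraph \<Rightarrow> 'a set \<Rightarrow> bool" where
  "scattered G C \<longleftrightarrow> (\<forall>a\<in>C. \<forall>b\<in>C. a \<noteq> b \<longrightarrow> far G a b)"

text \<open>The classes need not be disjoint: a vertex is labeled by the first class containing it.\<close>

lemma lambda21_le_length:
  assumes G: "pair_graph G" and ne: "pverts G \<noteq> {}"
    and cover: "pverts G \<subseteq> \<Union> (set cs)"
    and consec: "successively (separated G) cs"
    and scat: "\<forall>C\<in>set cs. scattered G C"
  shows "lambda21 G < length cs"
proof -
  define f where "f v = (LEAST i. i < length cs \<and> v \<in> cs ! i)" for v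
  have f: "f v < length cs \<and> v \<in> cs ! f v" if v: "v \<in> pverts G" for v
  proof -
    have "\<exists>i. i < length cs \<and> v \<in> cs ! i"
      using cover v by (metis UnionE in_set_conv_nth subsetD)
    then show ?thesis unfolding f_def by (rule LeastI_ex)
  qed
  \<comment> \<open>Consecutive labels belong to consecutive classes. As adjacent vertices also get
    distinct labels, these differ by at least 2.\<close>
  have nonarc: "(x, y) \<notin> parcs G"
    if "x \<in> pverts G" "y \<in> pverts G" "f y = Suc (f x)" for x y
  proof -
    have "separated G (cs ! f x) (cs ! f y)"
      using consec f[OF that(2)] that(3) by (auto simp: successively_conv_nth)
    then show ?thesis using f[OF that(1)] f[OF that(2)] by (auto simp: separated_def)
  qed
  have "L21_labeling G f"
    unfolding L21_labeling_def
  proof (intro ballI conjI impI)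
    fix x y assume xy: "x \<in> pverts G" "y \<in> pverts G"
    have neq: "f x \<noteq> f y" if "gdist G x y = 1 \<or> gdist G x y = 2"
    proof
      assume eq: "f x = f y"
      have "x \<noteq> y" using gdist_self[OF G xy(1)] that by auto
      moreover have "scattered G (cs ! f x)" using scat f[OF xy(1)] by auto
      ultimately have "far G x y" using f[OF xy(1)] f[OF xy(2)] eq by (auto simp: scattered_def)
      then have "gdist G x y > 2" by (rule far_gdist[OF G])
      then show False using that by auto
    qed
    show "1 \<le> \<bar>int (f x) - int (f y)\<bar>" if "gdist G x y = 2"
      using neq that by simp
    show "2 \<le> \<bar>int (f x) - int (f y)\<bar>" if "gdist G x y = 1"
    proof -
      have "(x, y) \<in> parcs G" "(y, x) \<in> parcs G"
        using gdist_1_imp_arc[OF G xy(1) that] pair_graph_arcD(4)[OF G] by auto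
      then have "f y \<noteq> Suc (f x)" "f x \<noteq> Suc (f y)" using nonarc xy by blast+
      then show ?thesis using neq that by linarith
    qed
  qed
  then have "lambda21 G \<le> Max (f ` pverts G)"
    unfolding lambda21_def by (intro Least_le) blast
  also have "\<dots> < length cs"
    using f ne pair_graph_finite[OF G] by simp
  finally show ?thesis .
qed

section \<open>Label classes in the second Mycielskian\<close>

abbreviation myc2 :: "'a mvert pair_pre_digraph \<Rightarrow> 'a mvert pair_pre_digraph" where
  "myc2 K \<equiv> mycielskian (mycielskian K)"

definition P_class :: "'a mvert \<Rightarrow> 'a mvert \<Rightarrow> 'a mvert set" where
  "P_class x y = {Old (Old x), Copy (Copy y)}"

definition Q_class :: "'a mvert \<Rightarrow> 'a mvert \<Rightarrow> 'a mvert set" where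
  "Q_class x y = {Old (Copy x), Copy (Old y)}"

text \<open>A common neighbour of \<open>Old x\<close> and \<open>Copy y\<close> must be
  \<open>Old z\<close> for a common neighbour \<open>z\<close> of \<open>x\<close> and
  \<open>y\<close>, since \<open>Root\<close> is adjacent to copies only.\<close>

lemma far_mycielskian:
  assumes "pair_graph K" "far K x y"
  shows "far (mycielskian K) (Old x) (Copy y)" "far (mycielskian K) (Copy x) (Old y)"
  using assms by (auto simp: far_def mycielskian_def dest: pair_graph_arcD(4))

lemma scattered_classes:
  assumes "pair_graph K" "far K x y"
  shows "scattered (myc2 K) (P_class x y)" "scattered (myc2 K) (Q_class x y)"
  using far_mycielskian[OF assms] assms(1)
  by (auto simp: scattered_def P_class_def Q_class_def
      intro: far_mycielskian far_sym pair_graph_mycielskian)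

text \<open>The class \<open>L\<close> can be followed by any block. For \<open>L = Q_class z z'\<close> the sets \<open>A\<close> and \<open>B\<close> are the
  neighbourhoods of \<open>z\<close> and \<open>z'\<close> in \<open>K\<close>.\<close>

definition enterable :: "'a mvert pair_pre_digraph \<Rightarrow> 'a mvert set \<Rightarrow> bool" where
  "enterable K L \<longleftrightarrow> (\<exists>A B. A \<inter> B = {} \<and>
     (\<forall>x y. far K x y \<longrightarrow> \<not> (x \<in> A \<and> y \<in> A) \<and> \<not> (x \<in> B \<and> y \<in> B)) \<and>
     (\<forall>x. separated (myc2 K) L {Copy (Copy x)}) \<and>
     (\<forall>x y. x \<notin> A \<union> B \<longrightarrow> separated (myc2 K) L (P_class x y)) \<and>
     (\<forall>x y. x \<in> A \<longrightarrow> y \<in> B \<longrightarrow> far K x y \<longrightarrow> separated (myc2 K) L (Q_class x y)))"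

text \<open>The neighbours of \<open>Copy Root\<close> are \<open>Root\<close> and the vertices
  \<open>Old (Copy x)\<close>, none of which lies in a \<open>P\<close> class. This class starts the
  chain of blocks.\<close>

lemma enterable_Copy_Root: "enterable K {Copy Root}"
  unfolding enterable_def
  by (rule exI[of _ "{}"], rule exI[of _ "{}"])
     (auto simp: separated_def mycielskian_def P_class_def)

lemma enterable_Old_Copy: "pair_graph K \<Longrightarrow> enterable K {Old (Copy z)}"
  unfolding enterable_def
  by (rule exI[of _ "{x. (z, x) \<in> parcs K}"], rule exI[of _ "{}"])
     (auto simp: separated_def mycielskian_def P_class_def far_def dest: pair_graph_arcD(4))

text \<open>Far vertices have no common neighbour, which makes the two neighbourhoods disjoint and
  forbids a far pair inside either. An edge to \<open>P_class x y\<close> needs \<open>x\<close>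
  adjacent to \<open>z\<close> or \<open>z'\<close>; an edge to \<open>Q_class x y\<close> needs
  \<open>x\<close> adjacent to \<open>z'\<close> or \<open>y\<close> adjacent to
  \<open>z\<close>.\<close>

lemma enterable_Q_class:
  assumes K: "pair_graph K" and zy: "far K z z'"
  shows "enterable K (Q_class z z')"
  unfolding enterable_def using zy K
  by (intro exI[of _ "{x. (z, x) \<in> parcs K}"] exI[of _ "{x. (z', x) \<in> parcs K}"])
    (auto simp: separated_def mycielskian_def P_class_def Q_class_def far_def
      dest: pair_graph_arcD(4))

text \<open>Any edge between the classes would require a loop of \<open>K\<close>, the edge
  \<open>xy\<close>, or an edge between two copies.\<close>

lemma separated_P_Q:
  assumes "pair_graph K" "far K x y"
  shows "separated (myc2 K) (P_class x y) (Q_class x y)"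
    and "separated (myc2 K) (Q_class x y) (P_class y z)"
    and "separated (myc2 K) (Q_class x y) (P_class x y)"
    and "separated (myc2 K) (P_class x y) (P_class y x)"
  using assms
  by (auto simp: separated_def mycielskian_def P_class_def Q_class_def far_def
      dest: pair_graph_arcD)

text \<open>Intended for a cycle listed with its first vertex repeated at the end, so that each edge
  contributes two classes.\<close>

fun cycle_classes :: "'a mvert list \<Rightarrow> 'a mvert set list" where
  "cycle_classes (x # y # zs) = P_class x y # Q_class x y # cycle_classes (y # zs)"
| "cycle_classes _ = []"

lemma length_cycle_classes: "length (cycle_classes (x # xs)) = 2 * length xs"
  by (induction xs arbitrary: x) auto

lemma hd_cycle_classes: "cycle_classes (x # xs) \<noteq> [] \<Longrightarrow> \<exists>y. hd (cycle_classes (x # xs)) = P_class x y"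
  by (cases xs) auto

lemma successively_cycle_classes:
  assumes "pair_graph K" "successively (far K) xs"
  shows "successively (separated (myc2 K)) (cycle_classes xs) \<and>
    (\<forall>C\<in>set (cycle_classes xs). scattered (myc2 K) C)"
  using assms(2)
proof (induction xs rule: cycle_classes.induct)
  case (1 x y zs)
  then have xy: "far K x y" and IH: "successively (separated (myc2 K)) (cycle_classes (y # zs))"
    "\<forall>C\<in>set (cycle_classes (y # zs)). scattered (myc2 K) C"
    by auto
  have "separated (myc2 K) (Q_class x y) (hd (cycle_classes (y # zs)))"
    if "cycle_classes (y # zs) \<noteq> []"
    using hd_cycle_classes[OF that] separated_P_Q(2)[OF assms(1) xy] by auto
  then show ?case
    using IH separated_P_Q(1)[OF assms(1) xy] scattered_classes[OF assms(1) xy]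
    by (auto simp: successively_Cons)
qed auto

lemma last_cycle_classes:
  assumes "successively (far K) (x # y # zs)"
  shows "\<exists>a b. far K a b \<and> last (cycle_classes (x # y # zs)) = Q_class a b"
  using assms
proof (induction zs arbitrary: x y)
  case (Cons z zs)
  then show ?case by (metis cycle_classes.simps(1) last.simps list.distinct(1) successively.simps(3))
qed auto

text \<open>An edge covers the \<open>Old\<close> vertices of its first end and the
  \<open>Copy\<close> vertices of its second. On a closed list both \<open>butlast\<close> and
  \<open>tl\<close> run through all vertices.\<close>

lemma cycle_classes_cover:
  shows "a \<in> set (butlast xs) \<Longrightarrow> {Old (Old a), Old (Copy a)} \<subseteq> \<Union> (set (cycle_classes xs))"
    and "b \<in> set (tl xs) \<Longrightarrow> {Copy (Old b), Copy (Copy b)} \<subseteq> \<Union> (set (cycle_classes xs))"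
proof (induction xs rule: cycle_classes.induct)
  case (1 x y zs)
  { case 1 then show ?case using "1.IH"(1) by (auto simp: P_class_def Q_class_def split: if_splits) }
  { case 2 then show ?case using "1.IH"(2) by (auto simp: P_class_def Q_class_def) }
qed auto

text \<open>The value flips at each step, and a list of odd length has an even number of
  steps.\<close>

lemma alternating_odd:
  assumes "successively (\<lambda>x y. c x \<noteq> c y) xs" "odd (length xs)"
  shows "(c (hd xs) :: bool) = c (last xs)"
  using assms
proof (induction xs rule: induct_list012)
  case (3 x y zs)
  then have "zs \<noteq> []" by auto
  then show ?case using 3 by (auto simp: successively_Cons)
qed auto

text \<open>If all vertices were in \<open>A \<union> B\<close>, membership in \<open>A\<close>
  would alternate along the list, so its two ends would agree although they are far. A vertex
  outside is then rotated to the front.\<close>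

lemma odd_cycle_rotation:
  assumes "odd (length xs)" "successively (far K) xs" "far K (last xs) (hd xs)"
    and "A \<inter> B = {}"
    and ind: "\<And>x y. far K x y \<Longrightarrow> \<not> (x \<in> A \<and> y \<in> A) \<and> \<not> (x \<in> B \<and> y \<in> B)"
  shows "\<exists>y ys. set (y # ys) = set xs \<and> length (y # ys) = length xs \<and> y \<notin> A \<union> B \<and>
    successively (far K) (y # ys @ [y])"
proof -
  have "\<exists>y \<in> set xs. y \<notin> A \<union> B"
  proof (rule ccontr)
    assume "\<not> ?thesis"
    then have AB: "set xs \<subseteq> A \<union> B" by auto
    have "successively (\<lambda>x y. (x \<in> A) \<noteq> (y \<in> A)) xs"
      by (rule successively_mono[OF assms(2)]) (use AB ind in blast)
    from alternating_odd[OF this assms(1)] have "hd xs \<in> A \<longleftrightarrow> last xs \<in> A" .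
    moreover have "xs \<noteq> []" using assms(1) by auto
    ultimately show False
      using ind[OF assms(3)] AB by (metis Un_iff hd_in_set last_in_set subsetD)
  qed
  then obtain y us vs where y: "y \<notin> A \<union> B" "xs = us @ y # vs"
    by (meson split_list)
  then show ?thesis
    using assms(2,3)
    by (intro exI[of _ y] exI[of _ "vs @ us"])
       (auto simp: successively_append_iff successively_Cons hd_append split: if_splits)
qed

text \<open>The list must begin with a class that may follow \<open>L\<close> and end with an
  enterable one, so that blocks can be chained. A single vertex yields four singletons, a pair its
  four classes, an odd cycle two classes per edge.\<close>

lemma block_classes:
  assumes K: "pair_graph K" and L: "enterable K L" and b: "block (far K) xs"
  shows "\<exists>cs. cs \<noteq> [] \<and> length cs = 2 * cost xs \<and> successively (separated (myc2 K)) (L # cs) \<and>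
    enterable K (last cs) \<and> (\<forall>C\<in>set cs. scattered (myc2 K) C) \<and>
    (\<forall>x\<in>set xs. {Old (Old x), Old (Copy x), Copy (Old x), Copy (Copy x)} \<subseteq> \<Union> (set cs))"
    (is "\<exists>cs. ?good xs cs")
proof -
  obtain A B where disj: "A \<inter> B = {}"
    and ind: "\<And>x y. far K x y \<Longrightarrow> \<not> (x \<in> A \<and> y \<in> A) \<and> \<not> (x \<in> B \<and> y \<in> B)"
    and CC: "\<And>x. separated (myc2 K) L {Copy (Copy x)}"
    and PP: "\<And>x y. x \<notin> A \<union> B \<Longrightarrow> separated (myc2 K) L (P_class x y)"
    and QQ: "\<And>x y. x \<in> A \<Longrightarrow> y \<in> B \<Longrightarrow> far K x y \<Longrightarrow> separated (myc2 K) L (Q_class x y)"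
    using L unfolding enterable_def by blast
  note sep = separated_P_Q[OF K] and scat = scattered_classes[OF K]
  consider x where "xs = [x]" | x y where "far K x y" "xs = [x, y]"
    | "odd (length xs)" "3 \<le> length xs" "successively (far K) xs" "far K (last xs) (hd xs)"
    using b unfolding block_def by blast
  then show ?thesis
  proof cases
    case 1
    have "?good xs [{Copy (Copy x)}, {Copy (Old x)}, {Old (Old x)}, {Old (Copy x)}]"
      using 1 CC[of x] enterable_Old_Copy[OF K] pair_graph_arcD(3)[OF K, of x x]
      by (auto simp: cost_def scattered_def separated_def mycielskian_def)
    then show ?thesis by blast
  next
    case 2
    \<comment> \<open>Entry at a vertex outside \<open>A \<union> B\<close>, with both
      \<open>P\<close> classes first.\<close>
    have P: "\<exists>cs. ?good xs cs" if "far K u v" "u \<notin> A \<union> B" "set xs = {u, v}" for u v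
    proof -
      have vu: "far K v u" by (rule far_sym[OF K that(1)])
      have "separated (myc2 K) (Q_class v u) (Q_class u v)"
        using pair_graph_arcD(3)[OF K, of v v] pair_graph_arcD(3)[OF K, of u u]
        by (auto simp: separated_def Q_class_def mycielskian_def)
      then have "?good xs [P_class u v, P_class v u, Q_class v u, Q_class u v]"
        using 2(2) that(3) PP[OF that(2), of v] sep(4)[OF that(1)] sep(1)[OF vu]
          scat[OF that(1)] scat[OF vu] enterable_Q_class[OF K that(1)]
        by (simp add: cost_def) (auto simp: P_class_def Q_class_def)
      then show ?thesis by blast
    qed
    \<comment> \<open>Both vertices lie in \<open>A \<union> B\<close>, so the entry is at
      \<open>Q_class u v\<close> and the \<open>P\<close> classes move to the middle.\<close>
    have Q: "\<exists>cs. ?good xs cs" if "far K u v" "u \<in> A" "v \<in> B" "set xs = {u, v}" for u v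
    proof -
      have vu: "far K v u" by (rule far_sym[OF K that(1)])
      have "?good xs [Q_class u v, P_class u v, P_class v u, Q_class v u]"
        using 2(2) that(4) QQ[OF that(2,3,1)] sep(3,4)[OF that(1)] sep(1)[OF vu]
          scat[OF that(1)] scat[OF vu] enterable_Q_class[OF K vu]
        by (simp add: cost_def) (auto simp: P_class_def Q_class_def)
      then show ?thesis by blast
    qed
    have yx: "far K y x" by (rule far_sym[OF K 2(1)])
    consider "x \<notin> A \<union> B" | "y \<notin> A \<union> B" | "x \<in> A" "y \<in> B" | "x \<in> B" "y \<in> A"
      using ind[OF 2(1)] by blast
    then show ?thesis
    proof cases
      case 1 then show ?thesis using P[OF \<open>far K x y\<close>] \<open>xs = [x, y]\<close> by simp
    next
      case 2
      then show ?thesis using P[OF yx] \<open>xs = [x, y]\<close> by (simp add: insert_commute)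
    next
      case 3 then show ?thesis using Q[OF \<open>far K x y\<close>] \<open>xs = [x, y]\<close> by simp
    next
      case 4 then show ?thesis using Q[OF yx] \<open>xs = [x, y]\<close> by (simp add: insert_commute)
    qed
  next
    case 3
    obtain y ys where y: "set (y # ys) = set xs" "length (y # ys) = length xs" "y \<notin> A \<union> B"
      and path: "successively (far K) (y # ys @ [y])"
      using odd_cycle_rotation[OF 3(1,3,4) disj ind] by blast
    let ?cs = "cycle_classes (y # ys @ [y])"
    have len: "length ?cs = 2 * length xs"
      using length_cycle_classes[of y "ys @ [y]"] y(2) by simp
    then have ne: "?cs \<noteq> []" using 3 by force
    obtain z zs where "ys @ [y] = z # zs" by (cases ys) auto
    then have "enterable K (last ?cs)"
      using last_cycle_classes[of K y z zs] path enterable_Q_class[OF K] by metis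
    moreover have "separated (myc2 K) L (hd ?cs)"
      using hd_cycle_classes[OF ne] PP[OF y(3)] by metis
    moreover have "{Old (Old x), Old (Copy x), Copy (Old x), Copy (Copy x)} \<subseteq> \<Union> (set ?cs)"
      if "x \<in> set xs" for x
      using cycle_classes_cover[of x "y # ys @ [y]"] that y(1) by (auto simp: butlast_append)
    ultimately have "?good xs ?cs"
      using len ne successively_cycle_classes[OF K path] 3
      by (simp add: successively_Cons cost_def)
    then show ?thesis by blast
  qed
qed

text \<open>The last class of one block plays the role of \<open>L\<close> for the next, hence the
  induction with \<open>L\<close> arbitrary.\<close>

lemma blocks_classes:
  assumes K: "pair_graph K" and "\<forall>b\<in>set bs. block (far K) b" and "enterable K L"
  shows "\<exists>cs. length cs = 2 * sum_list (map cost bs) \<and>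
    successively (separated (myc2 K)) (L # cs) \<and> (\<forall>C\<in>set cs. scattered (myc2 K) C) \<and>
    (\<forall>x\<in>\<Union> (set ` set bs).
      {Old (Old x), Old (Copy x), Copy (Old x), Copy (Copy x)} \<subseteq> \<Union> (set cs))"
  using assms(2,3)
proof (induction bs arbitrary: L)
  case Nil
  then show ?case by (intro exI[of _ "[]"]) simp
next
  case (Cons b bs)
  obtain cs where cs: "cs \<noteq> []" "length cs = 2 * cost b" "successively (separated (myc2 K)) (L # cs)"
    "enterable K (last cs)" "\<forall>C\<in>set cs. scattered (myc2 K) C"
    "\<forall>x\<in>set b. {Old (Old x), Old (Copy x), Copy (Old x), Copy (Copy x)} \<subseteq> \<Union> (set cs)"
    using block_classes[OF K Cons.prems(2), of b] Cons.prems(1) by auto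
  obtain ds where ds: "length ds = 2 * sum_list (map cost bs)"
    "successively (separated (myc2 K)) (last cs # ds)" "\<forall>C\<in>set ds. scattered (myc2 K) C"
    "\<forall>x\<in>\<Union> (set ` set bs).
      {Old (Old x), Old (Copy x), Copy (Old x), Copy (Copy x)} \<subseteq> \<Union> (set ds)"
    using Cons.IH[OF _ cs(4)] Cons.prems(1) by auto
  have "successively (separated (myc2 K)) (L # cs @ ds)"
    using cs(1,3) ds(2) by (auto simp: successively_Cons successively_append_iff)
  then show ?case
    using cs ds by (intro exI[of _ "cs @ ds"]) (auto simp: subset_iff)
qed

lemma lambda21_myc2_le:
  assumes K: "pair_graph K" and "\<forall>b\<in>set bs. block (far K) b"
    and cover: "\<Union> (set ` set bs) = pverts K"
  shows "lambda21 (myc2 K) \<le> 2 * sum_list (map cost bs) + 2"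
proof -
  obtain cs where cs: "length cs = 2 * sum_list (map cost bs)"
    "successively (separated (myc2 K)) ({Copy Root} # cs)" "\<forall>C\<in>set cs. scattered (myc2 K) C"
    "\<forall>x\<in>pverts K. {Old (Old x), Old (Copy x), Copy (Old x), Copy (Copy x)} \<subseteq> \<Union> (set cs)"
    using blocks_classes[OF K assms(2) enterable_Copy_Root] cover by auto
  \<comment> \<open>\<open>Root\<close> and \<open>Copy Root\<close> are adjacent;
    \<open>Old Root\<close>, adjacent to neither, is placed between them. The three extra classes
    add 3 to the length and, as labels start at 0, only 2 to the bound.\<close>
  let ?cs = "{Root} # {Old Root} # {Copy Root} # cs"
  have "lambda21 (myc2 K) < length ?cs"
  proof (rule lambda21_le_length)
    show "pair_graph (myc2 K)" using K pair_graph_mycielskian by blast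
    show "pverts (myc2 K) \<noteq> {}" by (simp add: mycielskian_def)
    show "pverts (myc2 K) \<subseteq> \<Union> (set ?cs)"
      using cs(4) by (auto simp: mycielskian_def)
    show "successively (separated (myc2 K)) ?cs"
      using cs(2) by (auto simp: separated_def mycielskian_def)
    show "\<forall>C\<in>set ?cs. scattered (myc2 K) C"
      using cs(3) by (auto simp: scattered_def)
  qed
  then show ?thesis using cs(1) by simp
qed

section \<open>2-matchings of iterated Mycielskians\<close>

text \<open>Edge weights are stored as a symmetric function of two vertices, so the total weight \<open>p\<close> of a
  2-matching appears as the double sum \<open>2 * p\<close>.\<close>

definition far_weight :: "'a pair_pre_digraph \<Rightarrow> ('a \<Rightarrow> 'a \<Rightarrow> nat) \<Rightarrow> bool" where
  "far_weight G w \<longleftrightarrow> (\<forall>x y. w x y = w y x) \<and> (\<forall>x y. w x y > 0 \<longrightarrow> far G x y) \<and>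
     (\<forall>x\<in>pverts G. (\<Sum>y\<in>pverts G. w x y) \<le> 2)"

lemma two_matching_far_weight:
  assumes G: "pair_graph G" and m: "two_matching (graph_complement (graph_square G)) m"
  shows "\<exists>w. far_weight G w \<and> (\<Sum>x\<in>pverts G. \<Sum>y\<in>pverts G. w x y) =
    2 * (\<Sum>e\<in>uedges (graph_complement (graph_square G)). m e)"
proof -
  let ?H = "graph_complement (graph_square G)"
  define w where "w x y = (if far G x y then m {x, y} else 0)" for x y
  have V: "pverts ?H = pverts G" by (simp add: graph_complement_def graph_square_def)
  have U: "uedges ?H = {{x, y} | x y. far G x y}"
    by (simp add: uedges_def complement_square_arc_iff[OF G])
  have fin: "finite (pverts G)" using G pair_graph_finite by blast
  have finU: "finite (uedges ?H)"
    by (rule finite_subset[of _ "Pow (pverts G)"]) (use fin in \<open>auto simp: U far_def\<close>)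
  have row: "(\<Sum>y\<in>pverts G. w x y) = (\<Sum>e\<in>{e \<in> uedges ?H. x \<in> e}. m e)" for x
  proof -
    have "(\<Sum>y\<in>pverts G. w x y) = (\<Sum>y\<in>{y \<in> pverts G. far G x y}. m {x, y})"
      using fin by (simp add: w_def sum.inter_filter)
    also have "\<dots> = (\<Sum>e\<in>(\<lambda>y. {x, y}) ` {y \<in> pverts G. far G x y}. m e)"
      by (subst sum.reindex) (auto simp: inj_on_def doubleton_eq_iff)
    also have "(\<lambda>y. {x, y}) ` {y \<in> pverts G. far G x y} = {e \<in> uedges ?H. x \<in> e}"
    proof (intro equalityI subsetI)
      fix e assume "e \<in> {e \<in> uedges ?H. x \<in> e}"
      then obtain y where "far G x y" "e = {x, y}"
        using far_sym[OF G] by (auto simp: U insert_commute)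
      then show "e \<in> (\<lambda>y. {x, y}) ` {y \<in> pverts G. far G x y}" by (auto simp: far_def)
    qed (auto simp: U)
    finally show ?thesis .
  qed
  have "(\<Sum>x\<in>pverts G. \<Sum>y\<in>pverts G. w x y)
      = (\<Sum>x\<in>pverts G. \<Sum>e\<in>uedges ?H. if x \<in> e then m e else 0)"
    using finU by (simp add: row sum.inter_filter)
  \<comment> \<open>Double counting: each edge is met once at each of its two ends.\<close>
  also have "\<dots> = (\<Sum>e\<in>uedges ?H. \<Sum>x\<in>pverts G. if x \<in> e then m e else 0)"
    by (rule sum.swap)
  also have "\<dots> = (\<Sum>e\<in>uedges ?H. 2 * m e)"
  proof (rule sum.cong[OF refl])
    fix e assume "e \<in> uedges ?H"
    then obtain x y where "e = {x, y}" "x \<noteq> y" "x \<in> pverts G" "y \<in> pverts G"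
      by (auto simp: U far_def)
    then have "{x \<in> pverts G. x \<in> e} = e" "card e = 2" by auto
    then show "(\<Sum>x\<in>pverts G. if x \<in> e then m e else 0) = 2 * m e"
      using fin by (simp flip: sum.inter_filter)
  qed
  finally have "(\<Sum>x\<in>pverts G. \<Sum>y\<in>pverts G. w x y) = 2 * (\<Sum>e\<in>uedges ?H. m e)"
    by (simp add: sum_distrib_left)
  moreover have "far_weight G w"
    unfolding far_weight_def
  proof (intro conjI allI impI ballI)
    show "w x y = w y x" for x y using far_sym[OF G] by (auto simp: w_def insert_commute)
    show "far G x y" if "w x y > 0" for x y using that by (auto simp: w_def split: if_splits)
    show "(\<Sum>y\<in>pverts G. w x y) \<le> 2" if "x \<in> pverts G" for x
      using m that by (simp add: row two_matching_def V)
  qed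
  ultimately show ?thesis by blast
qed

text \<open>There are infinitely many 2-matchings, as values off the edges are free, but their sizes
  are bounded by twice the number of edges, so the maximum is over a finite set.\<close>

lemma nu2_attained:
  assumes "finite (uedges H)"
  shows "\<exists>m. two_matching H m \<and> nu2 H = (\<Sum>e\<in>uedges H. m e)"
proof -
  let ?S = "{(\<Sum>e\<in>uedges H. m e) | m. two_matching H m}"
  have "?S \<subseteq> {..2 * card (uedges H)}"
  proof
    fix s assume "s \<in> ?S"
    then obtain m where m: "s = (\<Sum>e\<in>uedges H. m e)" "two_matching H m" by blast
    have "s \<le> (\<Sum>e\<in>uedges H. 2)"
      unfolding m(1) using m(2) by (intro sum_mono) (force simp: two_matching_def)
    then show "s \<in> {..2 * card (uedges H)}" by simp
  qed
  then have "finite ?S" using finite_subset by blast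
  moreover have "two_matching H (\<lambda>_. 0)" by (simp add: two_matching_def)
  then have "?S \<noteq> {}" by blast
  ultimately have "nu2 H \<in> ?S" unfolding nu2_def by (rule Max_in)
  then show ?thesis by blast
qed

lemma nu2_far_weight:
  assumes G: "pair_graph G"
  shows "\<exists>w. far_weight G w \<and> (\<Sum>x\<in>pverts G. \<Sum>y\<in>pverts G. w x y) =
    2 * nu2 (graph_complement (graph_square G))"
proof -
  have "uedges (graph_complement (graph_square G)) \<subseteq> Pow (pverts G)"
    by (auto simp: uedges_def graph_complement_def graph_square_def)
  then have "finite (uedges (graph_complement (graph_square G)))"
    using pair_graph_finite[OF G] finite_subset by blast
  then show ?thesis using nu2_attained two_matching_far_weight[OF G] by metis
qed

lemma far_weight_base:
  assumes "pair_graph G" "far_weight G w"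
  shows "\<exists>w'. far_weight (base_graph G) w' \<and>
    (\<Sum>x\<in>pverts (base_graph G). \<Sum>y\<in>pverts (base_graph G). w' x y) =
    (\<Sum>x\<in>pverts G. \<Sum>y\<in>pverts G. w x y)"
proof -
  define w' where "w' a b = (case (a, b) of (Base x, Base y) \<Rightarrow> w x y | _ \<Rightarrow> 0)" for a b
  have V: "pverts (base_graph G) = Base ` pverts G" by (simp add: base_graph_def)
  have row: "(\<Sum>b\<in>Base ` pverts G. w' (Base x) b) = (\<Sum>y\<in>pverts G. w x y)" for x
    by (subst sum.reindex) (auto simp: w'_def inj_on_def)
  have "(\<Sum>a\<in>Base ` pverts G. \<Sum>b\<in>Base ` pverts G. w' a b) = (\<Sum>x\<in>pverts G. \<Sum>y\<in>pverts G. w x y)"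
    by (subst sum.reindex) (auto simp: row inj_on_def)
  moreover have "far (base_graph G) (Base x) (Base y)" if "far G x y" for x y
    using that by (auto simp: far_def base_graph_def)
  then have "far_weight (base_graph G) w'"
    using assms(2) unfolding far_weight_def V
    by (auto simp: row) (auto simp: w'_def split: mvert.splits)
  ultimately show ?thesis using V by auto
qed

text \<open>The weight of \<open>xy\<close> is placed on both \<open>Old x, Copy y\<close> and
  \<open>Copy x, Old y\<close>. Every old row sum then occurs twice, and the row of
  \<open>Root\<close> is 0.\<close>

lemma far_weight_mycielskian:
  assumes G: "pair_graph G" and "far_weight G w"
  shows "\<exists>w'. far_weight (mycielskian G) w' \<and>
    (\<Sum>x\<in>pverts (mycielskian G). \<Sum>y\<in>pverts (mycielskian G). w' x y) =
    2 * (\<Sum>x\<in>pverts G. \<Sum>y\<in>pverts G. w x y)"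
proof -
  define w' where "w' a b = (case (a, b) of (Old x, Copy y) \<Rightarrow> w x y | (Copy x, Old y) \<Rightarrow> w x y
    | _ \<Rightarrow> 0)" for a b
  let ?V = "pverts G"
  have fin: "finite ?V" using G pair_graph_finite by blast
  have sum_V: "(\<Sum>a\<in>pverts (mycielskian G). f a) = (\<Sum>x\<in>?V. f (Old x)) + (\<Sum>x\<in>?V. f (Copy x)) + f Root"
    for f :: "'a mvert \<Rightarrow> nat"
  proof -
    have "(\<Sum>a\<in>pverts (mycielskian G). f a) = (\<Sum>a\<in>Old ` ?V \<union> Copy ` ?V. f a) + f Root"
      using fin by (simp add: mycielskian_def) (subst sum.insert, auto)
    also have "(\<Sum>a\<in>Old ` ?V \<union> Copy ` ?V. f a) = (\<Sum>a\<in>Old ` ?V. f a) + (\<Sum>a\<in>Copy ` ?V. f a)"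
      using fin by (intro sum.union_disjoint) auto
    finally show ?thesis by (simp add: sum.reindex inj_on_def)
  qed
  have "(\<Sum>b\<in>pverts (mycielskian G). w' a b) \<le> 2" if a: "a \<in> pverts (mycielskian G)" for a
  proof -
    consider x where "x \<in> ?V" "a = Old x" | x where "x \<in> ?V" "a = Copy x" | "a = Root"
      using a by (auto simp: mycielskian_def)
    then show ?thesis using assms(2) by cases (auto simp: sum_V w'_def far_weight_def)
  qed
  moreover have "w' a b = w' b a" for a b
    using assms(2) by (auto simp: w'_def far_weight_def split: mvert.splits)
  moreover have "far (mycielskian G) a b" if "w' a b > 0" for a b
    using that assms(2) far_mycielskian[OF G]
    by (auto simp: w'_def far_weight_def split: mvert.splits)
  ultimately have "far_weight (mycielskian G) w'" by (simp add: far_weight_def)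
  then show ?thesis by (intro exI[of _ w']) (simp add: sum_V w'_def)
qed

lemma far_weight_mycielski_iter:
  assumes G: "pair_graph G"
  shows "\<exists>w. far_weight (mycielski_iter s G) w \<and>
    (\<Sum>x\<in>pverts (mycielski_iter s G). \<Sum>y\<in>pverts (mycielski_iter s G). w x y) =
    2 ^ s * (2 * nu2 (graph_complement (graph_square G)))"
proof (induction s)
  case 0
  then show ?case
    using nu2_far_weight[OF G] far_weight_base[OF G] by (fastforce simp: mycielski_iter_def)
next
  case (Suc s)
  then show ?case
    using far_weight_mycielskian[OF pair_graph_mycielski_iter[OF G, of s]]
    by (fastforce simp: mycielski_iter_def)
qed

section \<open>Order of the iterated Mycielskian and the final bound\<close>

lemma card_mycielskian: "finite (pverts G) \<Longrightarrow> card (pverts (mycielskian G)) = 2 * card (pverts G) + 1"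
proof -
  assume fin: "finite (pverts G)"
  have "card (Old ` pverts G \<union> Copy ` pverts G) = card (pverts G) + card (pverts G)"
    using fin by (subst card_Un_disjoint) (auto simp: card_image inj_on_def)
  moreover have "Root \<notin> Old ` pverts G \<union> Copy ` pverts G" by auto
  ultimately show ?thesis using fin by (simp add: mycielskian_def)
qed

lemma card_mycielski_iter:
  assumes G: "pair_graph G"
  shows "card (pverts (mycielski_iter s G)) + 1 = 2 ^ s * (card (pverts G) + 1)"
proof (induction s)
  case 0
  then show ?case by (simp add: mycielski_iter_def base_graph_def card_image inj_on_def)
next
  case (Suc s)
  then show ?case
    using card_mycielskian[OF pair_graph_finite[OF pair_graph_mycielski_iter[OF G, of s]]]
    by (simp add: mycielski_iter_def)
qed

theorem theorem4p7:
  fixes G :: "'a pair_pre_digraph" and n p t :: nat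
  assumes "pair_graph G"
    and "card (pverts G) = n"
    and "n \<ge> 2"
    and "nu2 (graph_complement (graph_square G)) = p"
    and "t \<ge> 2"
  shows "int (lambda21 (mycielski_iter t G)) \<le> 2 ^ (t - 1) * (2 * int n - int p + 2) - 2"
proof -
  obtain s where t: "t = Suc (Suc s)" using assms(5) by (auto simp: nat_le_iff_add)
  let ?K = "mycielski_iter s G"
  have K: "pair_graph ?K" using pair_graph_mycielski_iter assms(1) by blast
  \<comment> \<open>Twice the weight \<open>2 ^ s * p\<close>, as the double sum counts every pair
    twice.\<close>
  define q where "q = 2 ^ s * (2 * p)"
  obtain w where w: "far_weight ?K w"
    "(\<Sum>x\<in>pverts ?K. \<Sum>y\<in>pverts ?K. w x y) = q"
    using far_weight_mycielski_iter[OF assms(1)] assms(4) q_def by blast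
  have "\<exists>bs. \<Union> (set ` set bs) = pverts ?K \<and> (\<forall>b \<in> set bs. block (far ?K) b) \<and>
    2 * sum_list (map cost bs) + (\<Sum>x\<in>pverts ?K. \<Sum>y\<in>pverts ?K. w x y) \<le> 4 * card (pverts ?K)"
    using w(1) pair_graph_finite[OF K] unfolding far_weight_def
    by (intro block_decomposition) (auto simp: far_def)
  then obtain bs where bs: "\<Union> (set ` set bs) = pverts ?K" "\<forall>b \<in> set bs. block (far ?K) b"
    "2 * sum_list (map cost bs) + q \<le> 4 * card (pverts ?K)"
    using w(2) by auto
  have "lambda21 (mycielski_iter t G) \<le> 2 * sum_list (map cost bs) + 2"
    using lambda21_myc2_le[OF K bs(2,1)] by (simp add: t mycielski_iter_def)
  \<comment> \<open>Everything is kept additive on naturals; subtraction appears only after the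
    passage to integers.\<close>
  then have "lambda21 (mycielski_iter t G) + q + 2 \<le> 4 * (card (pverts ?K) + 1)"
    using bs(3) by (simp add: algebra_simps)
  also have "\<dots> = 4 * (2 ^ s * (n + 1))"
    using card_mycielski_iter[OF assms(1), of s] assms(2) by simp
  finally have "int (lambda21 (mycielski_iter t G) + 2 ^ s * (2 * p) + 2) \<le> int (4 * (2 ^ s * (n + 1)))"
    by (simp only: of_nat_le_iff q_def)
  then show ?thesis by (simp add: t algebra_simps)
qed

end
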